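(* Let $C=\int f(\lambda)\,\delta_\lambda\,d\lambda$ be a continuous divisor on $\mathbb R_+^*$ with compact support. There exists a finite union of graphs $G_j^\pm$ of maps $$g_j^\pm:D_j^\pm\to\mathbb R_+^*,\qquad D_j^\pm\subset\hat{\mathbb Z}\subset G,$$ such that the leafwise discrete divisor $D:=\sum\pm G_j^\pm$ on $\Gamma_{\mathbb Q,\mathrm{cl}}=G\times\mathbb R_+^*$ is a lift of $C$.
   Context: $G:=\mathbb A_{\mathbb Q}/(\mathbb Q,+)\simeq(\hat{\mathbb Z}\times\mathbb R)/\mathbb Z$ (with $\mathbb Z$ embedded diagonally) is a compact abelian group, containing $\hat{\mathbb Z}$ as the image of $\hat{\mathbb Z}\times\{0\}$, and $a:\mathbb R\to G$, $a(t)=$ class of $(0,t)$, is an injective homomorphism with dense range. The space $\Gamma_{\mathbb Q,\mathrm{cl}}=G\times\mathbb R_+^*$ is foliated by the leaves $(x+a(\mathbb R))\times\mathbb R_+^*$, $x\in G$, each parametrized by $\mathbb H$ through $t+iy\mapsto(x+a(t),y)$. A continuous divisor on $\mathbb R_+^*$ with compact support is a formal integral $\int f(\lambda)\delta_\lambda\,d\lambda$, with $f$ a real-valued integrable function of compact support in $\mathbb R_+^*$; its pairing with a test function $\psi$ is $\int f(\lambda)\psi(\lambda)\,d\lambda$. The graph of $g:D\to\mathbb R_+^*$, $D\subset\hat{\mathbb Z}\subset G$, is $\{(\xi,g(\xi)):\xi\in D\}\subset G\times\mathbb R_+^*$; it meets each leaf in a discrete set, so that a finite signed sum $D=\sum\pm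 G_j^\pm$ of such graphs restricts on each leaf to a discrete integral divisor $\sum_k n_k\delta_{t_k+iy_k}$ (in the coordinate $t+iy\in\mathbb H$). $D$ is a lift of $C$ if it gives the same pairing after averaging: for every leaf and every continuous function $\psi$ on $\mathbb R_+^*$, $$\lim_{T\to\infty}\frac1{2T}\sum_{|t_k|\le T}n_k\,\psi(y_k)=\int f(\lambda)\psi(\lambda)\,d\lambda .$$ *)

theory Defs
  imports "HOL-Analysis.Analysis" "HOL-Algebra.Product_Groups" "HOL-Algebra.Elementary_Groups"
begin

text \<open>Groups are HOL-Algebra records, written multiplicatively although all of them are
  additive groups in the usual notation.\<close>

definition real_add_group :: "real monoid" where
  "real_add_group = \<lparr>carrier = UNIV, monoid.mult = (+), one = 0\<rparr>"

text \<open>The profinite integers, as the inverse limit of the groups \<open>\<int>/n\<int>\<close> over the positive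
  integers ordered by divisibility.  The index 0 is left out because
  \<^term>\<open>integer_mod_group 0\<close> is \<open>\<int>\<close>.\<close>

definition Zhat :: "(nat \<Rightarrow> int) monoid" where
  "Zhat = (product_group {0<..} integer_mod_group)
     \<lparr>carrier := {\<xi> \<in> carrier (product_group {0<..} integer_mod_group).
                   \<forall>m>0. \<forall>n>0. m dvd n \<longrightarrow> \<xi> n mod int m = \<xi> m}\<rparr>"

definition Zhat_of_int :: "int \<Rightarrow> nat \<Rightarrow> int" where
  "Zhat_of_int k = (\<lambda>n\<in>{0<..}. k mod int n)"

definition diagonal_Z :: "((nat \<Rightarrow> int) \<times> real) set" where
  "diagonal_Z = range (\<lambda>k::int. (Zhat_of_int k, real_of_int k))"

type_synonym solenoid_point = "((nat \<Rightarrow> int) \<times> real) set"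

definition solenoid :: "solenoid_point monoid" where
  "solenoid = (Zhat \<times>\<times> real_add_group) Mod diagonal_Z"

definition solenoid_class :: "(nat \<Rightarrow> int) \<times> real \<Rightarrow> solenoid_point" where
  "solenoid_class p = diagonal_Z #>\<^bsub>Zhat \<times>\<times> real_add_group\<^esub> p"

definition solenoid_of_Zhat :: "(nat \<Rightarrow> int) \<Rightarrow> solenoid_point" where
  "solenoid_of_Zhat \<xi> = solenoid_class (\<xi>, 0)"

definition solenoid_of_real :: "real \<Rightarrow> solenoid_point" where
  "solenoid_of_real t = solenoid_class (\<one>\<^bsub>Zhat\<^esub>, t)"

lemma group_Zhat_product: "group (product_group {0<..} integer_mod_group)"
  by simp

lemma subgroup_Zhat: "subgroup (carrier Zhat) (product_group {0<..} integer_mod_group)"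
proof -
  let ?P = "product_group {0<..} integer_mod_group"
  interpret group ?P by simp
  have C: "carrier Zhat = {\<xi> \<in> carrier ?P. \<forall>m>0. \<forall>n>0. m dvd n \<longrightarrow> \<xi> n mod int m = \<xi> m}"
    by (simp add: Zhat_def)
  show ?thesis
  proof (rule subgroupI)
    show "carrier Zhat \<subseteq> carrier ?P" by (auto simp: C)
    have "\<one>\<^bsub>?P\<^esub> \<in> carrier Zhat"
      using one_closed by (auto simp: C)
    then show "carrier Zhat \<noteq> {}" by blast
  next
    fix \<xi> assume \<xi>: "\<xi> \<in> carrier Zhat"
    then have P: "\<xi> \<in> carrier ?P" by (simp add: C)
    have i: "(inv\<^bsub>?P\<^esub> \<xi>) n = (- \<xi> n) mod int n" if "n > 0" for n
    proof -
      have "inv\<^bsub>?P\<^esub> \<xi> = (\<lambda>n\<in>{0<..}. inv\<^bsub>integer_mod_group n\<^esub> \<xi> n)"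
        using P by (intro inv_product_group) simp_all
      moreover have "\<xi> n \<in> carrier (integer_mod_group n)"
        using P that by (auto simp: PiE_iff)
      ultimately show ?thesis using that by simp
    qed
    have "(- \<xi> n) mod int n mod int m = (- \<xi> m) mod int m"
      if "m > 0" "n > 0" "m dvd n" for m n
    proof -
      have "(- \<xi> n) mod int n mod int m = (- (\<xi> n mod int m)) mod int m"
        using that by (simp add: mod_mod_cancel mod_minus_eq)
      then show ?thesis using \<xi> that by (simp add: C)
    qed
    then show "inv\<^bsub>?P\<^esub> \<xi> \<in> carrier Zhat"
      using inv_closed[OF P] i by (simp add: C)
  next
    fix \<xi> \<eta> assume \<xi>: "\<xi> \<in> carrier Zhat" and \<eta>: "\<eta> \<in> carrier Zhat"
    have "(\<xi> n + \<eta> n) mod int n mod int m = (\<xi> m + \<eta> m) mod int m"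
      if "m > 0" "n > 0" "m dvd n" for m n
    proof -
      have "(\<xi> n + \<eta> n) mod int n mod int m = (\<xi> n mod int m + \<eta> n mod int m) mod int m"
        using that by (simp add: mod_mod_cancel mod_add_eq)
      then show ?thesis using \<xi> \<eta> that by (simp add: C)
    qed
    moreover have "\<xi> \<otimes>\<^bsub>?P\<^esub> \<eta> \<in> carrier ?P"
      using \<xi> \<eta> by (intro m_closed) (auto simp: C)
    ultimately show "\<xi> \<otimes>\<^bsub>?P\<^esub> \<eta> \<in> carrier Zhat"
      by (simp add: C)
  qed
qed

lemma comm_group_Zhat: "comm_group Zhat"
proof -
  have "group Zhat"
    using group.subgroup_imp_group[OF group_Zhat_product subgroup_Zhat] by (simp add: Zhat_def)
  then show ?thesis
    by (rule group.group_comm_groupI) (auto simp: Zhat_def add.commute)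
qed

lemma comm_group_real_add_group: "comm_group real_add_group"
proof (rule comm_groupI)
  fix x assume "x \<in> carrier real_add_group"
  show "\<exists>y\<in>carrier real_add_group. y \<otimes>\<^bsub>real_add_group\<^esub> x = \<one>\<^bsub>real_add_group\<^esub>"
    by (rule bexI[of _ "- x"]) (auto simp: real_add_group_def)
qed (auto simp: real_add_group_def)

lemma comm_group_Zhat_real: "comm_group (Zhat \<times>\<times> real_add_group)"
proof (rule group.group_comm_groupI)
  show "group (Zhat \<times>\<times> real_add_group)"
    by (intro DirProd_group comm_group.axioms(2) comm_group_Zhat comm_group_real_add_group)
  show "\<And>x y. x \<in> carrier (Zhat \<times>\<times> real_add_group) \<Longrightarrow> y \<in> carrier (Zhat \<times>\<times> real_add_group)
    \<Longrightarrow> x \<otimes>\<^bsub>Zhat \<times>\<times> real_add_group\<^esub> y = y \<otimes>\<^bsub>Zhat \<times>\<times> real_add_group\<^esub> x"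
    by (auto simp: Zhat_def real_add_group_def add.commute)
qed

lemma Zhat_of_int_hom: "Zhat_of_int \<in> hom integer_group Zhat"
  by (auto simp: hom_def Zhat_def Zhat_of_int_def carrier_integer_mod_group mod_mod_cancel
      integer_group_def mod_add_eq fun_eq_iff)

lemma diagonal_Z_normal: "diagonal_Z \<lhd> Zhat \<times>\<times> real_add_group"
proof -
  have h: "(\<lambda>k. (Zhat_of_int k, real_of_int k)) \<in> hom integer_group (Zhat \<times>\<times> real_add_group)"
    using Zhat_of_int_hom by (auto simp: hom_def real_add_group_def integer_group_def)
  interpret group_hom integer_group "Zhat \<times>\<times> real_add_group"
    "\<lambda>k. (Zhat_of_int k, real_of_int k)"
    using h comm_group_Zhat_real by (simp add: group_hom_def group_hom_axioms_def comm_group_def)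
  have "subgroup diagonal_Z (Zhat \<times>\<times> real_add_group)"
    using img_is_subgroup by (simp add: diagonal_Z_def)
  then show ?thesis
    using comm_group.subgroup_imp_normal[OF comm_group_Zhat_real] by blast
qed

lemma comm_group_solenoid: "comm_group solenoid"
  unfolding solenoid_def
  by (rule comm_group.abelian_FactGroup[OF comm_group_Zhat_real])
     (rule normal_imp_subgroup[OF diagonal_Z_normal])

text \<open>A divisor on \<open>G \<times> \<real>\<^sub>+\<^sup>*\<close> is given by its multiplicity function.  The leaf of \<open>x\<close> is
  parametrized by the upper half plane through \<open>leaf_param x\<close>.\<close>

definition leaf_param :: "solenoid_point \<Rightarrow> complex \<Rightarrow> solenoid_point \<times> real" where
  "leaf_param x z = (x \<otimes>\<^bsub>solenoid\<^esub> solenoid_of_real (Re z), Im z)"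

definition leaf_support :: "(solenoid_point \<times> real \<Rightarrow> int) \<Rightarrow> solenoid_point \<Rightarrow> complex set" where
  "leaf_support D x = {z. Im z > 0 \<and> D (leaf_param x z) \<noteq> 0}"

definition leafwise_discrete :: "(solenoid_point \<times> real \<Rightarrow> int) \<Rightarrow> bool" where
  "leafwise_discrete D \<longleftrightarrow> (\<forall>x\<in>carrier solenoid. leaf_support D x sparse_in {z. Im z > 0})"

definition Zhat_graph ::
    "(nat \<Rightarrow> int) set \<Rightarrow> ((nat \<Rightarrow> int) \<Rightarrow> real) \<Rightarrow> (solenoid_point \<times> real) set" where
  "Zhat_graph A g = (\<lambda>\<xi>. (solenoid_of_Zhat \<xi>, g \<xi>)) ` A"

text \<open>The divisor \<open>\<integral> f(\<lambda>) \<delta>\<^sub>\<lambda> d\<lambda>\<close> is represented by its density \<open>f\<close>; the values of \<open>f\<close> outside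
  \<open>\<real>\<^sub>+\<^sup>*\<close> are irrelevant.\<close>

definition continuous_divisor_compact_support :: "(real \<Rightarrow> real) \<Rightarrow> bool" where
  "continuous_divisor_compact_support f \<longleftrightarrow>
     f absolutely_integrable_on {0<..} \<and>
     compact (closure {l. l > 0 \<and> f l \<noteq> 0}) \<and> closure {l. l > 0 \<and> f l \<noteq> 0} \<subseteq> {0<..}"

definition continuous_divisor_pairing :: "(real \<Rightarrow> real) \<Rightarrow> (real \<Rightarrow> real) \<Rightarrow> real" where
  "continuous_divisor_pairing f \<psi> = (LINT l:{0<..}|lebesgue. f l * \<psi> l)"

text \<open>The finiteness clause makes the sum over \<open>\<bar>t\<^sub>k\<bar> \<le> T\<close> a genuine finite sum.\<close>

definition is_lift :: "(solenoid_point \<times> real \<Rightarrow> int) \<Rightarrow> (real \<Rightarrow> real) \<Rightarrow> bool" where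
  "is_lift D f \<longleftrightarrow> (\<forall>x\<in>carrier solenoid.
     (\<forall>T. finite {z \<in> leaf_support D x. \<bar>Re z\<bar> \<le> T}) \<and>
     (\<forall>\<psi>::real \<Rightarrow> real. continuous_on {0<..} \<psi> \<longrightarrow>
        ((\<lambda>T. 1 / (2 * T) *
              (\<Sum>z\<in>{z \<in> leaf_support D x. \<bar>Re z\<bar> \<le> T}.
                 real_of_int (D (leaf_param x z)) * \<psi> (Im z)))
           \<longlongrightarrow> continuous_divisor_pairing f \<psi>) at_top))"

end

theory Submission
  imports Defs "HOL-Real_Asymp.Real_Asymp"
begin

text \<open>Write \<open>\<xi> - k\<close> for the translate \<open>Zhat_shift \<xi> k\<close> of \<open>\<xi> \<in> Zhat\<close> by the integer \<open>k\<close>.  The leaf through the class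
  of \<open>(\<xi>, s)\<close> meets the image of \<open>Zhat\<close> exactly at the times \<open>t = k - s\<close>, in the points \<open>\<xi> - k\<close>
  with \<open>k\<close> an integer.  So a graph of \<open>g\<close> over \<open>A\<close> marks on this leaf the points
  \<open>(k - s) + i g(\<xi> - k)\<close> with \<open>\<xi> - k \<in> A\<close>, and being a lift is a statement about ergodic averages
  of \<open>\<psi> \<circ> g\<close> along every orbit of the integer translations of \<open>Zhat\<close>.

  These averages can be controlled on every orbit, rather than almost every one, because there is an
  explicit function \<open>h : Zhat \<rightarrow> [0,1]\<close> that is uniformly distributed along all orbits: the van der
  Corput \<open>radical_inverse\<close>, which reads the binary digits of the 2-adic component backwards behind the
  binary point.  The first \<open>m\<close> digits of \<open>h \<xi>\<close> depend only on \<open>\<xi>\<close> modulo \<open>2 ^ m\<close>, and bijectively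
  so; hence each dyadic interval of length \<open>2 ^ -m\<close> is visited by one residue class modulo \<open>2 ^ m\<close>, up
  to endpoints, and the frequency of \<open>h \<le> u\<close> is \<open>u\<close> (lemma \<open>frequency_radical_inverse\<close>).

  For a density \<open>F \<ge> 1\<close> of total mass \<open>M\<close> on \<open>[a,b]\<close> let \<open>Q : [0,M] \<rightarrow> [a,b]\<close> be the inverse of the
  distribution function \<open>l \<mapsto> \<integral>\<^sub>a\<^sup>l F\<close>.  The intervals \<open>j + [0,1]\<close> with \<open>j < \<lceil>M\<rceil>\<close> cover \<open>[0,M]\<close>, so
  the graphs of \<open>\<xi> \<mapsto> Q (j + h \<xi>)\<close>, restricted to \<open>j + h \<xi> \<le> M\<close>, push the uniform
  distribution on \<open>[0,M]\<close> forward to \<open>F\<close> (lemma \<open>graphs_with_density\<close>).  Convergence is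
  first obtained for the indicators of \<open>{..l}\<close> and then extended to continuous test functions by
  uniform approximation with step functions (lemma \<open>averages_tendsto_integral\<close>).

  Finally a signed \<open>f\<close> supported in \<open>[a,b]\<close> is the difference of \<open>f + \<bar>f\<bar> + 1\<close> and \<open>\<bar>f\<bar> + 1\<close>.  Both are
  at least 1 on \<open>[a,b]\<close>, which is what makes the two distribution functions invertible; the positive
  and the negative graphs realize one of them each.\<close>

section \<open>Integers of a residue class in a long window\<close>

definition window :: "real \<Rightarrow> real \<Rightarrow> int set" where
  "window s T = {k. \<bar>real_of_int k - s\<bar> \<le> T}"

lemma finite_window: "finite (window s T)"
proof -
  have "window s T \<subseteq> {\<lceil>s - T\<rceil>..\<lfloor>s + T\<rfloor>}"
    by (auto simp: window_def ceiling_le_iff le_floor_iff abs_le_iff)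
  then show ?thesis
    using finite_subset by blast
qed

text \<open>A residue class is a progression \<open>c + N l\<close>, so the count is a number of integers \<open>l\<close> in an interval of
  length \<open>2 T / N\<close>.  The error bound is the same for all \<open>T\<close>, so it disappears on division by \<open>2 T\<close>.\<close>
lemma card_residue_class_window:
  fixes N c :: int
  assumes "N > 0" "T \<ge> 0"
  shows "\<bar>real (card {k \<in> window s T. k mod N = c mod N}) - 2 * T / N\<bar> \<le> 1"
proof -
  define \<alpha> where "\<alpha> = (s - T - c) / N"
  define \<beta> where "\<beta> = (s + T - c) / N"
  have "{k \<in> window s T. k mod N = c mod N} = (\<lambda>l. c + N * l) ` {\<lceil>\<alpha>\<rceil>..\<lfloor>\<beta>\<rfloor>}"
  proof -
    have *: "c + N * l \<in> window s T \<longleftrightarrow> l \<in> {\<lceil>\<alpha>\<rceil>..\<lfloor>\<beta>\<rfloor>}" for l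
      using assms
      by (auto simp: window_def \<alpha>_def \<beta>_def ceiling_le_iff le_floor_iff abs_le_iff field_simps)
    have "\<exists>l. k = c + N * l" if "k mod N = c mod N" for k
      using that by (metis mod_eqE)
    then show ?thesis
      using * by fastforce
  qed
  moreover have "inj (\<lambda>l. c + N * l)"
    using assms by (auto intro!: injI)
  ultimately have "card {k \<in> window s T. k mod N = c mod N} = nat (\<lfloor>\<beta>\<rfloor> - \<lceil>\<alpha>\<rceil> + 1)"
    by (simp add: card_image inj_on_subset[OF _ subset_UNIV] nat_diff_distrib)
  moreover have d: "\<beta> - \<alpha> = 2 * T / N"
    by (simp add: \<alpha>_def \<beta>_def diff_divide_distrib add_divide_distrib)
  moreover have "\<lfloor>\<beta>\<rfloor> - \<lceil>\<alpha>\<rceil> + 1 \<ge> 0"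
  proof -
    have "\<beta> - \<alpha> \<ge> 0"
      using assms d by simp
    then have "real_of_int (\<lfloor>\<beta>\<rfloor> - \<lceil>\<alpha>\<rceil> + 1) > -1"
      by linarith
    then show ?thesis by linarith
  qed
  ultimately show ?thesis
    by simp linarith
qed

lemma frequency_residues:
  fixes N c :: int
  assumes "N > 0" "R \<subseteq> {0..<N}"
  shows "((\<lambda>T. 1 / (2 * T) * real (card {k \<in> window s T. (c - k) mod N \<in> R}))
           \<longlongrightarrow> card R / N) at_top"
proof -
  define Q where "Q r T = {k \<in> window s T. k mod N = (c - r) mod N}" for r T
  have fin: "finite R"
    using assms(2) finite_subset by blast
  have iff: "(c - k) mod N = r \<longleftrightarrow> k mod N = (c - r) mod N" if "r \<in> R" for k r
  proof -
    have "r mod N = r"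
      using that assms by auto
    then have "(c - k) mod N = r \<longleftrightarrow> N dvd (c - k) - r"
      by (metis mod_eq_dvd_iff)
    also have "\<dots> \<longleftrightarrow> N dvd - (k - (c - r))"
      by (simp add: algebra_simps)
    also have "\<dots> \<longleftrightarrow> N dvd k - (c - r)"
      by (rule dvd_minus_iff)
    finally show ?thesis
      by (simp add: mod_eq_dvd_iff)
  qed
  have "{k \<in> window s T. (c - k) mod N \<in> R} = (\<Union>r\<in>R. Q r T)" for T
    unfolding Q_def
  proof (intro Set.set_eqI iffI)
    fix k assume "k \<in> {k \<in> window s T. (c - k) mod N \<in> R}"
    then show "k \<in> (\<Union>r\<in>R. {k \<in> window s T. k mod N = (c - r) mod N})"
      using iff[of "(c - k) mod N" k] by blast
  next
    fix k assume "k \<in> (\<Union>r\<in>R. {k \<in> window s T. k mod N = (c - r) mod N})"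
    then obtain r where "r \<in> R" "k \<in> window s T" "k mod N = (c - r) mod N"
      by blast
    then show "k \<in> {k \<in> window s T. (c - k) mod N \<in> R}"
      using iff[of r k] by simp
  qed
  moreover have "card (\<Union>r\<in>R. Q r T) = (\<Sum>r\<in>R. card (Q r T))" for T
    using iff fin finite_window by (intro card_UN_disjoint) (auto simp: Q_def, metis)
  moreover have "((\<lambda>T. 1 / (2 * T) * real (card (Q r T))) \<longlongrightarrow> 1 / N) at_top" for r
  proof -
    have "norm (1 / (2 * T) * real (card (Q r T)) - 1 / N) \<le> norm (1 / (2 * T))" if "T > 0" for T
    proof -
      have "1 / (2 * T) * real (card (Q r T)) - 1 / N
          = 1 / (2 * T) * (real (card (Q r T)) - 2 * T / N)"
        using that by (simp add: field_simps)
      also have "norm \<dots> \<le> norm (1 / (2 * T)) * 1"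
        unfolding norm_mult Q_def using card_residue_class_window[OF assms(1)] that
        by (intro mult_left_mono) auto
      finally show ?thesis by simp
    qed
    then have "\<forall>\<^sub>F T in at_top. norm (1 / (2 * T) * real (card (Q r T)) - 1 / N)
        \<le> norm (1 / (2 * T))"
      using eventually_gt_at_top[of 0] by (rule eventually_mono[rotated])
    moreover have "((\<lambda>T::real. 1 / (2 * T)) \<longlongrightarrow> 0) at_top"
      by real_asymp
    ultimately have "((\<lambda>T. 1 / (2 * T) * real (card (Q r T)) - 1 / N) \<longlongrightarrow> 0) at_top"
      by (rule Lim_transform_bound)
    then show ?thesis
      by (rule LIM_zero_cancel)
  qed
  then have "((\<lambda>T. \<Sum>r\<in>R. 1 / (2 * T) * real (card (Q r T))) \<longlongrightarrow> (\<Sum>r\<in>R. 1 / N)) at_top"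
    by (intro tendsto_sum)
  ultimately show ?thesis
    by (simp add: sum_distrib_left)
qed

section \<open>Equidistribution of the radical inverse along integer translates\<close>

text \<open>The digit of weight \<open>2 ^ k\<close> in \<open>c\<close> receives weight \<open>2 ^ (m - 1 - k)\<close>; digits from position \<open>m\<close> on are
  ignored.\<close>
primrec bit_reversal :: "nat \<Rightarrow> int \<Rightarrow> int" where
  "bit_reversal 0 c = 0"
| "bit_reversal (Suc m) c = 2 * bit_reversal m c + (c div 2 ^ m) mod 2"

lemma bit_reversal_range: "0 \<le> bit_reversal m c \<and> bit_reversal m c < 2 ^ m"
proof (induction m)
  case (Suc m)
  have "(c div 2 ^ m) mod 2 \<in> {0, 1}" by auto
  with Suc show ?case by auto
qed auto

lemma bit_reversal_eq_iff: "bit_reversal m c = bit_reversal m d \<longleftrightarrow> c mod 2 ^ m = d mod 2 ^ m"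
proof (induction m)
  case (Suc m)
  let ?b = "\<lambda>c::int. (c div 2 ^ m) mod 2"
  have b: "0 \<le> ?b c \<and> ?b c < 2" for c by simp
  have s: "c mod 2 ^ Suc m = 2 ^ m * ?b c + c mod 2 ^ m" for c :: int
    using zmod_zmult2_eq[of 2 c "2 ^ m"] by (simp add: mult.commute)
  have m: "0 \<le> c mod 2 ^ m \<and> c mod 2 ^ m < 2 ^ m" for c :: int by simp
  have "bit_reversal (Suc m) c = bit_reversal (Suc m) d \<longleftrightarrow>
      ?b c = ?b d \<and> bit_reversal m c = bit_reversal m d"
  proof -
    have "2 * x + y = 2 * x' + y' \<longleftrightarrow> y = y' \<and> x = x'"
      if "0 \<le> y \<and> y < 2" "0 \<le> y' \<and> y' < 2" for x y x' y' :: int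
      using that by presburger
    from this[OF b b] show ?thesis by simp
  qed
  also have "\<dots> \<longleftrightarrow> ?b c = ?b d \<and> c mod 2 ^ m = d mod 2 ^ m"
    using Suc by simp
  also have "\<dots> \<longleftrightarrow> c mod 2 ^ Suc m = d mod 2 ^ Suc m"
  proof
    assume e: "c mod 2 ^ Suc m = d mod 2 ^ Suc m"
    have "c mod 2 ^ m = d mod 2 ^ m"
      using e by (metis dvd_triv_right mod_mod_cancel power_Suc)
    then show "?b c = ?b d \<and> c mod 2 ^ m = d mod 2 ^ m"
      using e unfolding s by simp
  qed (simp only: s)
  finally show ?case .
qed simp

text \<open>An injective map from a finite set to itself is onto, so reversal permutes \<open>{0..<2 ^ m}\<close>.\<close>
lemma card_bit_reversal_less:
  assumes "0 \<le> i" "i \<le> 2 ^ m"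
  shows "card {r \<in> {0..<2 ^ m}. bit_reversal m r < i} = nat i"
proof -
  have inj: "inj_on (bit_reversal m) {0..<2 ^ m}"
    by (auto intro!: inj_onI simp: bit_reversal_eq_iff)
  have "bit_reversal m ` {0..<2 ^ m} \<subseteq> {0..<2 ^ m}"
    using bit_reversal_range by auto
  then have "bit_reversal m ` {0..<2 ^ m} = {0..<2 ^ m}"
    using inj by (intro endo_inj_surj) auto
  moreover have "f ` {x \<in> A. f x < i} = {y \<in> f ` A. y < i}" for f :: "int \<Rightarrow> int" and A
    by blast
  ultimately have "bit_reversal m ` {r \<in> {0..<2 ^ m}. bit_reversal m r < i}
      = {y \<in> {0..<2 ^ m}. y < i}"
    by (simp only:)
  also have "\<dots> = {0..<i}"
    using assms by auto
  finally have "bit_reversal m ` {r \<in> {0..<2 ^ m}. bit_reversal m r < i} = {0..<i}" .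
  moreover have "inj_on (bit_reversal m) {r \<in> {0..<2 ^ m}. bit_reversal m r < i}"
    using inj by (rule inj_on_subset) auto
  ultimately show ?thesis
    by (metis card_image card_atLeastLessThan_int diff_zero)
qed

definition Zhat_shift :: "(nat \<Rightarrow> int) \<Rightarrow> int \<Rightarrow> nat \<Rightarrow> int" where
  "Zhat_shift \<xi> k = (\<lambda>n\<in>{0<..}. (\<xi> n - k) mod int n)"

text \<open>The quotients increase in \<open>m\<close>, each step appending one binary digit, so the supremum is their
  limit.\<close>
definition radical_inverse :: "(nat \<Rightarrow> int) \<Rightarrow> real" where
  "radical_inverse \<xi> = (SUP m. bit_reversal m (\<xi> (2 ^ m)) / 2 ^ m)"

lemma mem_Zhat_iff:
  "\<xi> \<in> carrier Zhat \<longleftrightarrow> \<xi> \<in> (\<Pi>\<^sub>E n\<in>{0<..}. {0..<int n}) \<and>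
     (\<forall>m>0. \<forall>n>0. m dvd n \<longrightarrow> \<xi> n mod int m = \<xi> m)"
  by (auto simp: Zhat_def PiE_iff carrier_integer_mod_group)

lemma Zhat_shift_closed: "\<xi> \<in> carrier Zhat \<Longrightarrow> Zhat_shift \<xi> k \<in> carrier Zhat"
  unfolding mem_Zhat_iff Zhat_shift_def
  by (auto simp: PiE_iff mod_mod_cancel) (metis mod_diff_left_eq)

text \<open>Appending a digit turns \<open>r\<close> into \<open>2 r\<close> or \<open>2 r + 1\<close>, so the dyadic intervals
  \<open>[r / 2 ^ m, (r + 1) / 2 ^ m]\<close> are nested.  Compatibility of the components of \<open>\<xi>\<close> is used to see that the first
  \<open>m\<close> digits are the same at level \<open>m + 1\<close>.\<close>
lemma radical_inverse_bounds:
  assumes "\<xi> \<in> carrier Zhat"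
  shows "bit_reversal m (\<xi> (2 ^ m)) / 2 ^ m \<le> radical_inverse \<xi>"
    and "radical_inverse \<xi> \<le> (bit_reversal m (\<xi> (2 ^ m)) + 1) / 2 ^ m"
proof -
  let ?r = "\<lambda>m. bit_reversal m (\<xi> (2 ^ m))"
  have step: "?r (Suc m) \<in> {2 * ?r m, 2 * ?r m + 1}" for m
  proof -
    have "\<xi> (2 ^ Suc m) mod int (2 ^ m) = \<xi> (2 ^ m)"
      using assms unfolding mem_Zhat_iff by (meson le_imp_power_dvd lessI less_imp_le zero_less_numeral zero_less_power)
    then have "\<xi> (2 ^ Suc m) mod 2 ^ m = \<xi> (2 ^ m) mod 2 ^ m"
      by (metis mod_mod_trivial of_nat_numeral of_nat_power)
    then have "bit_reversal m (\<xi> (2 ^ Suc m)) = ?r m"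
      by (simp add: bit_reversal_eq_iff)
    then show ?thesis by auto
  qed
  have *: "x / 2 ^ m \<le> y / 2 ^ Suc m \<and> (y + 1) / 2 ^ Suc m \<le> (x + 1) / 2 ^ m"
    if "y \<in> {2 * x, 2 * x + 1}" for x y :: int and m
    using that by (auto simp: field_simps)
  note up = conjunct1[OF *[OF step]] and down = conjunct2[OF *[OF step]]
  have inc: "?r m / 2 ^ m \<le> ?r n / 2 ^ n" if "m \<le> n" for m n
    using lift_Suc_mono_le[of "\<lambda>m. ?r m / 2 ^ m"] up that by blast
  have dec: "(?r n + 1) / 2 ^ n \<le> (?r m + 1) / 2 ^ m" if "m \<le> n" for m n
    using lift_Suc_antimono_le[of "\<lambda>m. (?r m + 1) / 2 ^ m"] down that by blast
  have le: "?r n / 2 ^ n \<le> (?r m + 1) / 2 ^ m" for m n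
  proof -
    have "?r n / 2 ^ n \<le> ?r (max m n) / 2 ^ max m n"
      by (rule inc) simp
    also have "\<dots> \<le> (?r (max m n) + 1) / 2 ^ max m n"
      by (simp add: divide_right_mono)
    also have "\<dots> \<le> (?r m + 1) / 2 ^ m"
      by (rule dec) simp
    finally show ?thesis .
  qed
  show "?r m / 2 ^ m \<le> radical_inverse \<xi>"
    unfolding radical_inverse_def using le[of _ 0]
    by (intro cSUP_upper bdd_aboveI2[where M = "(?r 0 + 1) / 2 ^ 0"]) auto
  show "radical_inverse \<xi> \<le> (?r m + 1) / 2 ^ m"
    unfolding radical_inverse_def using le by (intro cSUP_least) auto
qed

lemma radical_inverse_unit_interval:
  assumes "\<xi> \<in> carrier Zhat"
  shows "radical_inverse \<xi> \<in> {0..1}"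
  using radical_inverse_bounds[OF assms, of 0] by simp

lemma frequency_bit_reversal:
  assumes \<xi>: "\<xi> \<in> carrier Zhat" and i: "0 \<le> i" "i \<le> 2 ^ m"
  shows "((\<lambda>T. 1 / (2 * T) *
            real (card {k \<in> window s T. bit_reversal m (Zhat_shift \<xi> k (2 ^ m)) < i}))
           \<longlongrightarrow> i / 2 ^ m) at_top"
proof -
  let ?R = "{r \<in> {0..<2 ^ m}. bit_reversal m r < i}"
  have "(\<xi> (2 ^ m) - k) mod 2 ^ m \<in> ?R \<longleftrightarrow> bit_reversal m (Zhat_shift \<xi> k (2 ^ m)) < i" for k
    by (simp add: Zhat_shift_def)
  moreover have "?R \<subseteq> {0..<2 ^ m}"
    by blast
  ultimately show ?thesis
    using frequency_residues[of "2 ^ m" ?R s "\<xi> (2 ^ m)"] i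
    unfolding card_bit_reversal_less[OF i] by simp
qed

text \<open>At level \<open>m\<close> the event \<open>h \<le> u\<close> lies between two unions of residue classes modulo \<open>2 ^ m\<close>, whose
  frequencies differ from the clamped \<open>u\<close> by at most \<open>2 ^ -m\<close>.  Values of \<open>u\<close> outside \<open>[0,1]\<close> occur
  when the mass interval is cut into unit pieces.\<close>
lemma frequency_radical_inverse:
  assumes \<xi>: "\<xi> \<in> carrier Zhat"
  shows "((\<lambda>T. 1 / (2 * T) * real (card {k \<in> window s T. radical_inverse (Zhat_shift \<xi> k) \<le> u}))
           \<longlongrightarrow> max 0 (min 1 u)) at_top"
    (is "(?F \<longlongrightarrow> ?v) at_top")
proof (rule tendstoI)
  fix e :: real assume "e > 0"
  then obtain m where "(1/2) ^ m < e / 2"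
    using real_arch_pow_inv[of "e / 2" "1 / 2"] by auto
  then have m: "1 / 2 ^ m < e / 2"
    by (simp add: power_one_over)
  let ?A = "\<lambda>i T. 1 / (2 * T) *
    real (card {k \<in> window s T. bit_reversal m (Zhat_shift \<xi> k (2 ^ m)) < i})"
  \<comment> \<open>numbers of level-\<open>m\<close> dyadic intervals in \<open>{0..1}\<close> with right, respectively left, endpoint at most \<open>u\<close>\<close>
  define l where "l = max 0 (min (2 ^ m) \<lfloor>u * 2 ^ m\<rfloor>)"
  define r where "r = max 0 (min (2 ^ m) (\<lfloor>u * 2 ^ m\<rfloor> + 1))"
  have l: "0 \<le> l" "l \<le> 2 ^ m" and r: "0 \<le> r" "r \<le> 2 ^ m"
    by (auto simp: l_def r_def)
  have cl: "radical_inverse (Zhat_shift \<xi> k) \<le> u"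
    if "bit_reversal m (Zhat_shift \<xi> k (2 ^ m)) < l" for k
  proof -
    let ?b = "bit_reversal m (Zhat_shift \<xi> k (2 ^ m))"
    have "?b + 1 \<le> \<lfloor>u * 2 ^ m\<rfloor>"
      using that bit_reversal_range[of m "Zhat_shift \<xi> k (2 ^ m)"] by (auto simp: l_def)
    then have "?b + 1 \<le> u * 2 ^ m"
      by (simp add: le_floor_iff)
    then have "(?b + 1) / 2 ^ m \<le> u"
      by (simp add: field_simps)
    then show ?thesis
      using radical_inverse_bounds(2)[OF Zhat_shift_closed[OF \<xi>], of k m] by simp
  qed
  have cr: "bit_reversal m (Zhat_shift \<xi> k (2 ^ m)) < r"
    if "radical_inverse (Zhat_shift \<xi> k) \<le> u" for k
  proof -
    let ?b = "bit_reversal m (Zhat_shift \<xi> k (2 ^ m))"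
    have "?b / 2 ^ m \<le> u"
      using that radical_inverse_bounds(1)[OF Zhat_shift_closed[OF \<xi>], of m k] by simp
    then have "?b \<le> u * 2 ^ m"
      by (simp add: field_simps)
    then have "?b \<le> \<lfloor>u * 2 ^ m\<rfloor>"
      by (simp add: le_floor_iff)
    then show ?thesis
      using bit_reversal_range[of m "Zhat_shift \<xi> k (2 ^ m)"] by (auto simp: r_def)
  qed
  have lv: "?v - 1 / 2 ^ m \<le> l / 2 ^ m" and rv: "r / 2 ^ m \<le> ?v + 1 / 2 ^ m"
  proof -
    have P: "(2::real) ^ m > 0" by simp
    define w where "w = u * 2 ^ m"
    have w: "real_of_int \<lfloor>w\<rfloor> \<le> w" "w < real_of_int \<lfloor>w\<rfloor> + 1"
      by (rule of_int_floor_le, rule real_of_int_floor_add_one_gt)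
    have v: "?v * 2 ^ m = max 0 (min (2 ^ m) w)"
    proof -
      have "max 0 (min 1 u) * p = max 0 (min p (u * p))" if "p > 0" for p :: real
        using that by (auto simp: max_def min_def zero_le_mult_iff)
      from this[OF P] show ?thesis by (simp add: w_def)
    qed
    have "max 0 (min p w) - 1 \<le> max 0 (min p q) \<and>
        max 0 (min p (q + 1)) \<le> max 0 (min p w) + 1"
      if "p > 0" "q \<le> w" "w < q + 1" for p q :: real
      using that by (auto simp: max_def min_def)
    note this[OF P w]
    then have "max 0 (min (2 ^ m) w) - 1 \<le> l" "r \<le> max 0 (min (2 ^ m) w) + 1"
      by (simp_all add: l_def r_def w_def of_int_max of_int_min)
    then have "(?v * 2 ^ m - 1) / 2 ^ m \<le> l / 2 ^ m" "r / 2 ^ m \<le> (?v * 2 ^ m + 1) / 2 ^ m"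
      unfolding v by (simp_all add: divide_right_mono)
    then show "?v - 1 / 2 ^ m \<le> l / 2 ^ m" "r / 2 ^ m \<le> ?v + 1 / 2 ^ m"
      by (simp_all only: diff_divide_distrib add_divide_distrib nonzero_mult_div_cancel_right
          power_not_zero zero_neq_numeral[symmetric] not_False_eq_True)
  qed
  have "\<forall>\<^sub>F T in at_top. dist (?A l T) (l / 2 ^ m) < e / 2"
    using \<open>e > 0\<close> by (intro tendstoD frequency_bit_reversal \<xi> l) simp
  moreover have "\<forall>\<^sub>F T in at_top. dist (?A r T) (r / 2 ^ m) < e / 2"
    using \<open>e > 0\<close> by (intro tendstoD frequency_bit_reversal \<xi> r) simp
  ultimately show "\<forall>\<^sub>F T in at_top. dist (?F T) ?v < e"
    using eventually_gt_at_top[of 0]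
  proof eventually_elim
    case (elim T)
    have "?A l T \<le> ?F T"
      using cl elim finite_window by (intro mult_left_mono of_nat_mono card_mono) auto
    moreover have "?F T \<le> ?A r T"
      using cr elim finite_window by (intro mult_left_mono of_nat_mono card_mono) auto
    ultimately show ?case
      using elim lv rv m unfolding dist_real_def by linarith
  qed
qed

section \<open>From distribution functions to continuous test functions\<close>

text \<open>Summation by parts writes the step function with value \<open>\<psi> (l (Suc i))\<close> on \<open>{l i<..l (Suc i)}\<close>
  as a combination of the indicators of \<open>{..l i}\<close>, the functions whose averages are known.\<close>
lemma abs_diff_sum_upper_steps_le:
  fixes \<psi> :: "real \<Rightarrow> real"
  assumes "\<And>i. i < n \<Longrightarrow> l i \<le> l (Suc i)" "y \<in> {l 0..l n}"
    and osc: "\<And>i x. i < n \<Longrightarrow> x \<in> {l i..l (Suc i)} \<Longrightarrow> \<bar>\<psi> (l (Suc i)) - \<psi> x\<bar> \<le> e"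
    and "e \<ge> 0"
  shows "\<bar>\<psi> (l n) - (\<Sum>i<n. (\<psi> (l (Suc i)) - \<psi> (l i)) * of_bool (y \<le> l i)) - \<psi> y\<bar> \<le> e"
  using assms
proof (induction n)
  case 0
  then show ?case by simp
next
  case (Suc n)
  show ?case
  proof (cases "y \<le> l n")
    case True
    then have "\<bar>\<psi> (l n) - (\<Sum>i<n. (\<psi> (l (Suc i)) - \<psi> (l i)) * of_bool (y \<le> l i)) - \<psi> y\<bar> \<le> e"
      using Suc by (intro Suc.IH) auto
    with True show ?thesis by simp
  next
    case False
    have "l i \<le> l n" if "i \<le> n" for i
      using that Suc.prems(1) by (induction n) (auto simp: le_Suc_eq intro: order_trans)
    then have "(\<Sum>i<Suc n. (\<psi> (l (Suc i)) - \<psi> (l i)) * of_bool (y \<le> l i)) = 0"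
      using False by (intro sum.neutral ballI) (simp add: less_Suc_eq_le, meson order_trans)
    moreover have "\<bar>\<psi> (l (Suc n)) - \<psi> y\<bar> \<le> e"
      using False Suc.prems(2) by (intro Suc.prems(3)) auto
    ultimately show ?thesis by simp
  qed
qed

lemma absolutely_integrable_mult_continuous:
  fixes f \<psi> :: "real \<Rightarrow> real"
  assumes "f absolutely_integrable_on {a..b}" "continuous_on {a..b} \<psi>"
  shows "(\<lambda>x. f x * \<psi> x) absolutely_integrable_on {a..b}"
proof -
  have "(\<lambda>x. \<psi> x * f x) absolutely_integrable_on {a..b}"
  proof (rule absolutely_integrable_bounded_measurable_product_real)
    show "\<psi> \<in> borel_measurable (lebesgue_on {a..b})"
      using assms(2) by (intro continuous_imp_measurable_on_sets_lebesgue) auto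
    show "bounded (\<psi> ` {a..b})"
      using assms(2) compact_continuous_image compact_imp_bounded by blast
  qed (use assms in auto)
  then show ?thesis
    by (simp add: mult.commute)
qed

lemma has_integral_mult_of_bool_le:
  fixes f :: "real \<Rightarrow> real"
  assumes "f integrable_on {a..b}" "l \<in> {a..b}"
  shows "((\<lambda>x. f x * of_bool (x \<le> l)) has_integral integral {a..l} f) {a..b}"
proof -
  have "f integrable_on {a..l}"
    using assms by (auto intro: integrable_on_subinterval)
  then have "(f has_integral integral {a..l} f) {a..l}"
    by (rule integrable_integral)
  then have "((\<lambda>x. if x \<in> {a..l} then f x else 0) has_integral integral {a..l} f) {a..b}"
    using assms(2) by (subst has_integral_restrict) auto
  then show ?thesis
    by (rule has_integral_eq[rotated]) auto
qed

text \<open>The points \<open>y i\<close> carry the measures \<open>1 / (2 T) \<Sum> \<delta>\<close>.  If their distribution functions converge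
  to that of \<open>f\<close>, they converge weakly: a continuous \<open>\<psi>\<close> is within \<open>e\<close> of a step function on
  \<open>{a..b}\<close>, and the error on both sides is at most \<open>e\<close> times the total mass.\<close>
lemma averages_tendsto_integral:
  fixes f \<psi> :: "real \<Rightarrow> real" and y :: "'i \<Rightarrow> real" and S :: "real \<Rightarrow> 'i set"
  assumes "a \<le> b" and f: "f absolutely_integrable_on {a..b}" "\<And>x. x \<in> {a..b} \<Longrightarrow> f x \<ge> 0"
    and S: "\<And>T. finite (S T)" "\<And>T i. i \<in> S T \<Longrightarrow> y i \<in> {a..b}"
    and distr: "\<And>l. l \<in> {a..b} \<Longrightarrow>
      ((\<lambda>T. 1 / (2 * T) * (\<Sum>i\<in>S T. of_bool (y i \<le> l))) \<longlongrightarrow> integral {a..l} f) at_top"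
    and \<psi>: "continuous_on {a..b} \<psi>"
  shows "((\<lambda>T. 1 / (2 * T) * (\<Sum>i\<in>S T. \<psi> (y i))) \<longlongrightarrow> integral {a..b} (\<lambda>x. f x * \<psi> x)) at_top"
proof (rule tendstoI)
  fix r :: real assume "r > 0"
  define A where "A \<phi> T = 1 / (2 * T) * (\<Sum>i\<in>S T. \<phi> (y i))" for \<phi> :: "real \<Rightarrow> real" and T
  define I where "I \<phi> = integral {a..b} (\<lambda>x. f x * \<phi> x)" for \<phi>
  define M where "M = integral {a..b} f"
  have f': "f integrable_on {a..b}"
    using f(1) by (simp add: absolutely_integrable_on_def)
  have "M \<ge> 0"
    unfolding M_def using f f' by (intro integral_nonneg) auto
  \<comment> \<open>at the end the error is at most \<open>e * (M + 1) + e + e * M\<close>\<close>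
  define e where "e = r / (2 * M + 2)"
  have e: "e > 0" "e * (2 * M + 2) = r"
    using \<open>r > 0\<close> \<open>M \<ge> 0\<close> by (auto simp: e_def)
  have "uniformly_continuous_on {a..b} \<psi>"
    using \<psi> compact_uniformly_continuous by blast
  then obtain d where d: "d > 0"
    "\<And>x x'. x \<in> {a..b} \<Longrightarrow> x' \<in> {a..b} \<Longrightarrow> dist x' x < d \<Longrightarrow> dist (\<psi> x') (\<psi> x) < e"
    using e(1) unfolding uniformly_continuous_on_def by metis
  obtain n :: nat where "(b - a) / d < real n"
    using reals_Archimedean2 by blast
  moreover have "(b - a) / d \<ge> 0"
    using d(1) \<open>a \<le> b\<close> by simp
  ultimately have "(b - a) / d < real n" "real n > 0"
    by linarith+
  then have n: "n > 0" "(b - a) / real n < d"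
    using d(1) by (simp_all add: divide_less_eq mult.commute)
  define l where "l i = a + real i * ((b - a) / n)" for i
  have l0: "l 0 = a" and ln: "l n = b" and lS: "l (Suc i) = l i + (b - a) / n" for i
    using n by (auto simp: l_def field_simps)
  have l: "l i \<in> {a..b}" if "i \<le> n" for i
  proof -
    have "real i * ((b - a) / n) \<le> real n * ((b - a) / n)"
      using that \<open>a \<le> b\<close> by (intro mult_right_mono) auto
    then show ?thesis
      using \<open>a \<le> b\<close> n by (auto simp: l_def)
  qed
  define \<phi> where
    "\<phi> y = \<psi> b - (\<Sum>i<n. (\<psi> (l (Suc i)) - \<psi> (l i)) * of_bool (y \<le> l i))" for y
  have close: "\<bar>\<phi> x - \<psi> x\<bar> \<le> e" if "x \<in> {a..b}" for x
    unfolding \<phi>_def ln[symmetric]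
  proof (rule abs_diff_sum_upper_steps_le)
    fix i x assume i: "i < n" "x \<in> {l i..l (Suc i)}"
    then have "x \<in> {a..b}" "l (Suc i) \<in> {a..b}"
      using l[of i] l[of "Suc i"] by auto
    moreover have "dist (l (Suc i)) x < d"
      using i n lS[of i] by (auto simp: dist_real_def)
    ultimately show "\<bar>\<psi> (l (Suc i)) - \<psi> x\<bar> \<le> e"
      using d(2)[of x "l (Suc i)"] by (auto simp: dist_real_def)
  qed (use that e l0 ln lS \<open>a \<le> b\<close> in auto)
  have "((\<lambda>T. \<psi> b * A (\<lambda>x. of_bool (x \<le> b)) T
      - (\<Sum>i<n. (\<psi> (l (Suc i)) - \<psi> (l i)) * A (\<lambda>x. of_bool (x \<le> l i)) T))
      \<longlongrightarrow> \<psi> b * M - (\<Sum>i<n. (\<psi> (l (Suc i)) - \<psi> (l i)) * integral {a..l i} f)) at_top"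
    unfolding A_def M_def using l \<open>a \<le> b\<close> by (intro tendsto_intros distr) auto
  moreover have "A \<phi> = (\<lambda>T. \<psi> b * A (\<lambda>x. of_bool (x \<le> b)) T
      - (\<Sum>i<n. (\<psi> (l (Suc i)) - \<psi> (l i)) * A (\<lambda>x. of_bool (x \<le> l i)) T))"
  proof
    fix T
    have "(\<Sum>k\<in>S T. \<phi> (y k)) = (\<Sum>k\<in>S T. \<psi> b * of_bool (y k \<le> b))
        - (\<Sum>k\<in>S T. \<Sum>i<n. (\<psi> (l (Suc i)) - \<psi> (l i)) * of_bool (y k \<le> l i))"
      unfolding \<phi>_def sum_subtractf using S(2) by (auto intro!: sum.cong)
    also have "(\<Sum>k\<in>S T. \<Sum>i<n. (\<psi> (l (Suc i)) - \<psi> (l i)) * of_bool (y k \<le> l i))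
        = (\<Sum>i<n. (\<psi> (l (Suc i)) - \<psi> (l i)) * (\<Sum>k\<in>S T. of_bool (y k \<le> l i)))"
      by (subst sum.swap) (simp add: sum_distrib_left)
    finally show "A \<phi> T = \<psi> b * A (\<lambda>x. of_bool (x \<le> b)) T
        - (\<Sum>i<n. (\<psi> (l (Suc i)) - \<psi> (l i)) * A (\<lambda>x. of_bool (x \<le> l i)) T)"
      by (simp add: A_def sum_distrib_left right_diff_distrib diff_divide_distrib
          sum_divide_distrib mult_ac)
  qed
  moreover have I\<phi>: "((\<lambda>x. f x * \<phi> x) has_integral
      \<psi> b * M - (\<Sum>i<n. (\<psi> (l (Suc i)) - \<psi> (l i)) * integral {a..l i} f)) {a..b}"
  proof -
    have "((\<lambda>x. \<psi> b * f x
        - (\<Sum>i<n. (\<psi> (l (Suc i)) - \<psi> (l i)) * (f x * of_bool (x \<le> l i)))) has_integral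
        \<psi> b * M - (\<Sum>i<n. (\<psi> (l (Suc i)) - \<psi> (l i)) * integral {a..l i} f)) {a..b}"
      unfolding M_def using l f'
      by (intro has_integral_diff has_integral_mult_right has_integral_sum
          has_integral_mult_of_bool_le integrable_integral) auto
    then show ?thesis
      by (simp add: \<phi>_def right_diff_distrib sum_distrib_left mult_ac)
  qed
  ultimately have lim\<phi>: "(A \<phi> \<longlongrightarrow> I \<phi>) at_top"
    by (simp add: I_def integral_unique)
  have I: "\<bar>I \<phi> - I \<psi>\<bar> \<le> e * M"
  proof -
    have \<psi>I: "(\<lambda>x. f x * \<psi> x) integrable_on {a..b}"
      using absolutely_integrable_mult_continuous[OF f(1) \<psi>]
      by (simp add: absolutely_integrable_on_def)
    have "I \<phi> - I \<psi> = integral {a..b} (\<lambda>x. f x * \<phi> x - f x * \<psi> x)"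
      unfolding I_def using I\<phi> \<psi>I by (intro integral_diff[symmetric]) auto
    also have "norm \<dots> \<le> integral {a..b} (\<lambda>x. e * f x)"
    proof (rule integral_norm_bound_integral)
      show "norm (f x * \<phi> x - f x * \<psi> x) \<le> e * f x" if "x \<in> {a..b}" for x
      proof -
        have "norm (f x * \<phi> x - f x * \<psi> x) = f x * \<bar>\<phi> x - \<psi> x\<bar>"
          using f(2)[OF that] by (simp add: right_diff_distrib[symmetric] abs_mult)
        also have "\<dots> \<le> f x * e"
          using f(2)[OF that] close[OF that] by (intro mult_left_mono)
        finally show ?thesis by (simp add: mult.commute)
      qed
      show "(\<lambda>x. f x * \<phi> x - f x * \<psi> x) integrable_on {a..b}"
        using I\<phi> \<psi>I by (intro integrable_diff) auto
      show "(\<lambda>x. e * f x) integrable_on {a..b}"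
        using integrable_cmul[OF f', of e] by simp
    qed
    also have "\<dots> = e * M"
      by (simp add: M_def)
    finally show ?thesis by simp
  qed
  have A: "\<bar>A \<phi> T - A \<psi> T\<bar> \<le> e * A (\<lambda>x. of_bool (x \<le> b)) T" if "T > 0" for T
  proof -
    have "A \<phi> T - A \<psi> T = 1 / (2 * T) * (\<Sum>i\<in>S T. \<phi> (y i) - \<psi> (y i))"
      by (simp add: A_def sum_subtractf right_diff_distrib)
    also have "\<bar>\<dots>\<bar> = 1 / (2 * T) * \<bar>\<Sum>i\<in>S T. \<phi> (y i) - \<psi> (y i)\<bar>"
      using that by (simp add: abs_mult)
    also have "\<dots> \<le> 1 / (2 * T) * (\<Sum>i\<in>S T. e * of_bool (y i \<le> b))"
    proof (rule mult_left_mono)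
      have "\<bar>\<Sum>i\<in>S T. \<phi> (y i) - \<psi> (y i)\<bar> \<le> (\<Sum>i\<in>S T. \<bar>\<phi> (y i) - \<psi> (y i)\<bar>)"
        by (rule sum_abs)
      also have "\<dots> \<le> (\<Sum>i\<in>S T. e * of_bool (y i \<le> b))"
        using S(2) close by (intro sum_mono) force
      finally show "\<bar>\<Sum>i\<in>S T. \<phi> (y i) - \<psi> (y i)\<bar> \<le> (\<Sum>i\<in>S T. e * of_bool (y i \<le> b))" .
    qed (use that in auto)
    also have "\<dots> = e * A (\<lambda>x. of_bool (x \<le> b)) T"
      by (simp add: A_def sum_distrib_left mult_ac)
    finally show ?thesis .
  qed
  have "\<forall>\<^sub>F T in at_top. dist (A (\<lambda>x. of_bool (x \<le> b)) T) M < 1"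
    using tendstoD[OF distr[of b], of 1] \<open>a \<le> b\<close> by (simp add: A_def M_def)
  moreover have "\<forall>\<^sub>F T in at_top. dist (A \<phi> T) (I \<phi>) < e"
    using tendstoD[OF lim\<phi>] e by simp
  ultimately have "\<forall>\<^sub>F T in at_top. dist (A \<psi> T) (I \<psi>) < r"
    using eventually_gt_at_top[of 0]
  proof eventually_elim
    case (elim T)
    have "A (\<lambda>x. of_bool (x \<le> b)) T \<le> M + 1"
      using elim by (simp add: dist_real_def)
    then have "e * A (\<lambda>x. of_bool (x \<le> b)) T \<le> e * (M + 1)"
      using e(1) by (intro mult_left_mono) auto
    then have "\<bar>A \<psi> T - I \<psi>\<bar> < e * (M + 1) + e + e * M"
      using A[of T] I elim by (simp add: dist_real_def)
    also have "\<dots> = r"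
      using e(2) by (simp add: algebra_simps)
    finally show ?case by (simp add: dist_real_def)
  qed
  then show "\<forall>\<^sub>F T in at_top. dist (1 / (2 * T) * (\<Sum>i\<in>S T. \<psi> (y i)))
      (integral {a..b} (\<lambda>x. f x * \<psi> x)) < r"
    by (simp add: A_def I_def)
qed

section \<open>Prescribing a positive density\<close>

text \<open>The unit intervals \<open>{j..j + 1}\<close> with \<open>j < p\<close> cut \<open>{0..v}\<close> into pieces of these lengths.\<close>
lemma sum_clamp:
  assumes "0 \<le> v" "v \<le> real p"
  shows "(\<Sum>j<p. max 0 (min 1 (v - real j))) = v"
proof -
  have "(\<Sum>j<p. max 0 (min 1 (v - real j))) = max 0 (min (real p) v)"
    by (induction p) (use assms(1) in \<open>auto simp: max_def min_def\<close>)
  then show ?thesis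
    using assms by simp
qed

text \<open>The lower bound 1 makes the indefinite integral strictly increasing, so it has a genuine inverse.
  The second property is the one that matters: it turns the event \<open>Q v \<le> l\<close> into a bound on \<open>v\<close>.\<close>
lemma indefinite_integral_inverse:
  fixes f :: "real \<Rightarrow> real"
  assumes f: "f integrable_on {a..b}" "\<And>x. x \<in> {a..b} \<Longrightarrow> f x \<ge> 1" and "a \<le> b"
  obtains Q where "\<And>v. v \<in> {0..integral {a..b} f} \<Longrightarrow> Q v \<in> {a..b}"
    and "\<And>v l. v \<in> {0..integral {a..b} f} \<Longrightarrow> l \<in> {a..b} \<Longrightarrow> Q v \<le> l \<longleftrightarrow> v \<le> integral {a..l} f"
proof -
  define G where "G l = integral {a..l} f" for l
  have int: "f integrable_on {x..y}" if "x \<in> {a..b}" "y \<in> {a..b}" for x y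
    using f(1) that by (auto intro: integrable_on_subinterval)
  have less: "G x < G y" if "x \<in> {a..b}" "y \<in> {a..b}" "x < y" for x y
  proof -
    have "G x + integral {x..y} f = G y"
      unfolding G_def using that int[of a y] by (intro Henstock_Kurzweil_Integration.integral_combine) auto
    moreover have "integral {x..y} (\<lambda>_. 1) \<le> integral {x..y} f"
      using that f(2) int[of x y] by (intro integral_le) auto
    ultimately show ?thesis
      using that by simp
  qed
  have mono: "G x \<le> G y \<longleftrightarrow> x \<le> y" if "x \<in> {a..b}" "y \<in> {a..b}" for x y
    using less[of x y] less[of y x] that by (cases x y rule: linorder_cases) auto
  have "\<exists>x\<in>{a..b}. G x = v" if "v \<in> {0..integral {a..b} f}" for v
  proof -
    have "continuous_on {a..b} G"
      unfolding G_def by (rule indefinite_integral_continuous_1[OF f(1)])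
    then show ?thesis
      using IVT'[of G a v b] that \<open>a \<le> b\<close> by (auto simp: G_def)
  qed
  then obtain Q where Q: "\<And>v. v \<in> {0..integral {a..b} f} \<Longrightarrow> Q v \<in> {a..b} \<and> G (Q v) = v"
    by metis
  then have "Q v \<le> l \<longleftrightarrow> v \<le> G l" if "v \<in> {0..integral {a..b} f}" "l \<in> {a..b}" for v l
    using mono[of "Q v" l] that by simp
  then show ?thesis
    using Q that by (metis G_def)
qed

text \<open>The values \<open>j + h \<xi>\<close> sweep \<open>{0..M}\<close> uniformly, the last graph being cut off at \<open>M\<close>, and \<open>Q\<close>
  carries the uniform distribution to the one with density \<open>f\<close>.\<close>
lemma graphs_with_density:
  fixes f :: "real \<Rightarrow> real"
  assumes "a \<le> b" and f: "f absolutely_integrable_on {a..b}" "\<And>x. x \<in> {a..b} \<Longrightarrow> f x \<ge> 1"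
  obtains p :: nat and A :: "nat \<Rightarrow> (nat \<Rightarrow> int) set" and g :: "nat \<Rightarrow> (nat \<Rightarrow> int) \<Rightarrow> real"
  where "\<And>j. A j \<subseteq> carrier Zhat" "\<And>j. g j \<in> A j \<rightarrow> {a..b}"
    and "\<And>\<xi> s \<psi>. \<xi> \<in> carrier Zhat \<Longrightarrow> continuous_on {a..b} \<psi> \<Longrightarrow>
      ((\<lambda>T. 1 / (2 * T) * (\<Sum>j<p. \<Sum>k\<in>{k \<in> window s T. Zhat_shift \<xi> k \<in> A j}.
          \<psi> (g j (Zhat_shift \<xi> k))))
        \<longlongrightarrow> integral {a..b} (\<lambda>x. f x * \<psi> x)) at_top"
proof -
  define G where "G l = integral {a..l} f" for l
  define M where "M = integral {a..b} f"
  have int: "f integrable_on {a..b}"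
    using f(1) by (simp add: absolutely_integrable_on_def)
  obtain Q where Q: "\<And>v. v \<in> {0..M} \<Longrightarrow> Q v \<in> {a..b}"
      "\<And>v l. v \<in> {0..M} \<Longrightarrow> l \<in> {a..b} \<Longrightarrow> Q v \<le> l \<longleftrightarrow> v \<le> G l"
    using indefinite_integral_inverse[OF int f(2) \<open>a \<le> b\<close>] unfolding M_def G_def by metis
  have G: "0 \<le> G l" "G l \<le> M" if "l \<in> {a..b}" for l
  proof -
    have "f integrable_on {a..l}" "f integrable_on {l..b}"
      using int that by (auto intro: integrable_on_subinterval)
    moreover have "f x \<ge> 0" if "x \<in> {a..b}" for x
      using f(2)[OF that] by simp
    ultimately have "0 \<le> G l" "0 \<le> integral {l..b} f"
      unfolding G_def using that by (auto intro!: Henstock_Kurzweil_Integration.integral_nonneg)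
    moreover have "G l + integral {l..b} f = M"
      unfolding G_def M_def using that int by (intro Henstock_Kurzweil_Integration.integral_combine) auto
    ultimately show "0 \<le> G l" "G l \<le> M" by auto
  qed
  define p where "p = nat \<lceil>M\<rceil>"
  have "M \<le> real p"
    unfolding p_def by (rule real_nat_ceiling_ge)
  define A where "A j = {\<xi> \<in> carrier Zhat. real j + radical_inverse \<xi> \<le> M}" for j
  define g where "g j \<xi> = Q (real j + radical_inverse \<xi>)" for j \<xi>
  have v: "real j + radical_inverse \<xi> \<in> {0..M}" if "\<xi> \<in> A j" for j \<xi>
    using that radical_inverse_unit_interval[of \<xi>] by (auto simp: A_def)
  have g: "g j \<xi> \<in> {a..b}" if "\<xi> \<in> A j" for j \<xi>
    unfolding g_def by (rule Q(1)[OF v[OF that]])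
  have "((\<lambda>T. 1 / (2 * T) * (\<Sum>j<p. \<Sum>k\<in>{k \<in> window s T. Zhat_shift \<xi> k \<in> A j}.
          \<psi> (g j (Zhat_shift \<xi> k))))
        \<longlongrightarrow> integral {a..b} (\<lambda>x. f x * \<psi> x)) at_top"
    if \<xi>: "\<xi> \<in> carrier Zhat" and \<psi>: "continuous_on {a..b} \<psi>" for \<xi> s \<psi>
  proof -
    define S where "S T = (SIGMA j:{..<p}. {k \<in> window s T. Zhat_shift \<xi> k \<in> A j})" for T
    define y where "y = (\<lambda>(j, k). g j (Zhat_shift \<xi> k))"
    have fin: "finite {k \<in> window s T. P k}" for P T
      by (simp add: finite_window)
    have sum_S: "(\<Sum>i\<in>S T. \<phi> (y i)) =
        (\<Sum>j<p. \<Sum>k\<in>{k \<in> window s T. Zhat_shift \<xi> k \<in> A j}. \<phi> (g j (Zhat_shift \<xi> k)))"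
      for \<phi> :: "real \<Rightarrow> real" and T
      unfolding S_def y_def by (subst sum.Sigma) (auto simp: fin intro!: sum.cong)
    have "((\<lambda>T. 1 / (2 * T) * (\<Sum>i\<in>S T. \<psi> (y i))) \<longlongrightarrow> integral {a..b} (\<lambda>x. f x * \<psi> x)) at_top"
    proof (rule averages_tendsto_integral[OF \<open>a \<le> b\<close> f(1)])
      show "f x \<ge> 0" if "x \<in> {a..b}" for x
        using f(2)[OF that] by simp
      show "finite (S T)" for T
        unfolding S_def by (intro finite_SigmaI) (auto simp: fin)
      show "y i \<in> {a..b}" if "i \<in> S T" for i T
        using that g unfolding S_def y_def by auto
    next
      fix l assume l: "l \<in> {a..b}"
      \<comment> \<open>for \<open>l \<le> b\<close> the cut-off at \<open>M\<close> is implied, since the value of the distribution function at \<open>l\<close> is at most \<open>M\<close>\<close>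
      have "(\<Sum>i\<in>S T. of_bool (y i \<le> l)) =
          (\<Sum>j<p. real (card {k \<in> window s T. radical_inverse (Zhat_shift \<xi> k) \<le> G l - real j}))"
        for T
        unfolding sum_S[of "\<lambda>v. of_bool (v \<le> l)"]
      proof (rule sum.cong)
        fix j
        have "g j (Zhat_shift \<xi> k) \<le> l \<longleftrightarrow> radical_inverse (Zhat_shift \<xi> k) \<le> G l - real j"
          if "Zhat_shift \<xi> k \<in> A j" for k
          unfolding g_def using Q(2)[OF v[OF that] l] by linarith
        moreover have "Zhat_shift \<xi> k \<in> A j"
          if "radical_inverse (Zhat_shift \<xi> k) \<le> G l - real j" for k
          using that G(2)[OF l] Zhat_shift_closed[OF \<xi>] by (auto simp: A_def)
        ultimately have "{k \<in> {k \<in> window s T. Zhat_shift \<xi> k \<in> A j}. g j (Zhat_shift \<xi> k) \<le> l}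
            = {k \<in> window s T. radical_inverse (Zhat_shift \<xi> k) \<le> G l - real j}"
          by blast
        then show "(\<Sum>k\<in>{k \<in> window s T. Zhat_shift \<xi> k \<in> A j}. of_bool (g j (Zhat_shift \<xi> k) \<le> l))
            = real (card {k \<in> window s T. radical_inverse (Zhat_shift \<xi> k) \<le> G l - real j})"
          by (simp add: sum_of_bool_eq fin Int_def)
      qed simp
      then have "(\<lambda>T. 1 / (2 * T) * (\<Sum>i\<in>S T. of_bool (y i \<le> l))) = (\<lambda>T. \<Sum>j<p. 1 / (2 * T) *
          real (card {k \<in> window s T. radical_inverse (Zhat_shift \<xi> k) \<le> G l - real j}))"
        by (simp add: sum_distrib_left)
      moreover have "((\<lambda>T. \<Sum>j<p. 1 / (2 * T) *
          real (card {k \<in> window s T. radical_inverse (Zhat_shift \<xi> k) \<le> G l - real j}))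
          \<longlongrightarrow> (\<Sum>j<p. max 0 (min 1 (G l - real j)))) at_top"
        by (intro tendsto_sum frequency_radical_inverse \<xi>)
      moreover have "(\<Sum>j<p. max 0 (min 1 (G l - real j))) = G l"
        using G[OF l] \<open>M \<le> real p\<close> by (intro sum_clamp) auto
      ultimately show "((\<lambda>T. 1 / (2 * T) * (\<Sum>i\<in>S T. of_bool (y i \<le> l)))
          \<longlongrightarrow> integral {a..l} f) at_top"
        by (simp add: G_def)
    qed (rule \<psi>)
    then show ?thesis
      by (simp only: sum_S[of \<psi>])
  qed
  moreover have "A j \<subseteq> carrier Zhat" "g j \<in> A j \<rightarrow> {a..b}" for j
    using g by (auto simp: A_def)
  ultimately show ?thesis
    using that by blast
qed

section \<open>Leaves of the solenoid and graphs over the profinite integers\<close>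

text \<open>This identifies the translation \<open>\<xi> - k\<close>, defined componentwise, with the group structure of
  \<open>Zhat\<close>.\<close>
lemma Zhat_shift_eq_iff:
  assumes "\<xi> \<in> carrier Zhat" "\<eta> \<in> carrier Zhat"
  shows "\<xi> = Zhat_of_int k \<otimes>\<^bsub>Zhat\<^esub> \<eta> \<longleftrightarrow> \<eta> = Zhat_shift \<xi> k"
proof -
  have range: "\<zeta> n mod int n = \<zeta> n" "\<zeta> \<in> extensional {0<..}" if "\<zeta> \<in> carrier Zhat" "n > 0" for \<zeta> n
    using that by (auto simp: mem_Zhat_iff PiE_iff)
  have "(k mod int n + \<eta> n) mod int n = \<xi> n \<longleftrightarrow> (\<xi> n - k) mod int n = \<eta> n" if "n > 0" for n
  proof -
    have "(k mod int n + \<eta> n) mod int n = \<xi> n \<longleftrightarrow> (k + \<eta> n) mod int n = \<xi> n mod int n"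
      using range(1)[OF assms(1) that] by (simp add: mod_add_left_eq)
    also have "\<dots> \<longleftrightarrow> int n dvd k + \<eta> n - \<xi> n"
      by (rule mod_eq_dvd_iff)
    also have "\<dots> \<longleftrightarrow> int n dvd - (\<xi> n - k - \<eta> n)"
      by (simp add: algebra_simps)
    also have "\<dots> \<longleftrightarrow> (\<xi> n - k) mod int n = \<eta> n mod int n"
      by (simp only: dvd_minus_iff mod_eq_dvd_iff)
    finally show ?thesis
      using range(1)[OF assms(2) that] by simp
  qed
  note iff = this
  have ext: "\<xi> = \<zeta> \<longleftrightarrow> (\<forall>n>0. \<zeta> n = \<xi> n)" "\<eta> = \<zeta> \<longleftrightarrow> (\<forall>n>0. \<zeta> n = \<eta> n)"
    if "\<zeta> \<in> extensional {0<..}" for \<zeta>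
    using that range(2)[OF assms(1), of 1] range(2)[OF assms(2), of 1]
    by (auto simp: extensional_def fun_eq_iff) (metis less_not_refl2 not_gr_zero)+
  have "Zhat_of_int k \<otimes>\<^bsub>Zhat\<^esub> \<eta> = (\<lambda>n\<in>{0<..}. (k mod int n + \<eta> n) mod int n)"
    by (auto simp: Zhat_def Zhat_of_int_def fun_eq_iff)
  then show ?thesis
    unfolding Zhat_shift_def by (subst ext(1), simp, subst ext(2), simp) (simp add: iff)
qed

lemma mem_solenoid_class_iff:
  assumes "\<xi> \<in> carrier Zhat" "\<eta> \<in> carrier Zhat"
  shows "(\<xi>, t) \<in> solenoid_class (\<eta>, s) \<longleftrightarrow> (\<exists>k::int. t = real_of_int k + s \<and> \<eta> = Zhat_shift \<xi> k)"
proof -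
  have "(\<xi>, t) \<in> solenoid_class (\<eta>, s) \<longleftrightarrow>
      (\<exists>k::int. t = real_of_int k + s \<and> \<xi> = Zhat_of_int k \<otimes>\<^bsub>Zhat\<^esub> \<eta>)"
    by (auto simp: solenoid_class_def r_coset_def diagonal_Z_def real_add_group_def)
  then show ?thesis
    using Zhat_shift_eq_iff[OF assms] by simp
qed

lemma mem_Zhat_real_iff: "(\<xi>, t) \<in> carrier (Zhat \<times>\<times> real_add_group) \<longleftrightarrow> \<xi> \<in> carrier Zhat"
  by (simp add: real_add_group_def)

lemma solenoid_class_eq_iff:
  assumes "\<xi> \<in> carrier Zhat" "\<eta> \<in> carrier Zhat"
  shows "solenoid_class (\<xi>, t) = solenoid_class (\<eta>, s) \<longleftrightarrow>
    (\<exists>k::int. t = real_of_int k + s \<and> \<eta> = Zhat_shift \<xi> k)"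
proof -
  interpret comm_group "Zhat \<times>\<times> real_add_group"
    by (rule comm_group_Zhat_real)
  have "subgroup diagonal_Z (Zhat \<times>\<times> real_add_group)"
    by (rule normal_imp_subgroup[OF diagonal_Z_normal])
  then have "solenoid_class (\<xi>, t) = solenoid_class (\<eta>, s) \<longleftrightarrow> (\<xi>, t) \<in> solenoid_class (\<eta>, s)"
    unfolding solenoid_class_def
    using repr_independence[of "(\<xi>, t)" diagonal_Z "(\<eta>, s)"]
      repr_independenceD[of diagonal_Z "(\<xi>, t)" "(\<eta>, s)"] assms mem_Zhat_real_iff
    by metis
  then show ?thesis
    using mem_solenoid_class_iff[OF assms] by simp
qed

lemma solenoid_cases:
  assumes "x \<in> carrier solenoid"
  obtains \<xi> s where "\<xi> \<in> carrier Zhat" "x = solenoid_class (\<xi>, s)"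
  using assms
  by (auto simp: solenoid_def FactGroup_def RCOSETS_def solenoid_class_def real_add_group_def)

lemma leaf_param_solenoid_class:
  assumes "\<xi> \<in> carrier Zhat"
  shows "leaf_param (solenoid_class (\<xi>, s)) z = (solenoid_class (\<xi>, s + Re z), Im z)"
proof -
  interpret Z: comm_group Zhat
    by (rule comm_group_Zhat)
  interpret normal diagonal_Z "Zhat \<times>\<times> real_add_group"
    by (rule diagonal_Z_normal)
  have "solenoid_class (\<xi>, s) \<otimes>\<^bsub>solenoid\<^esub> solenoid_of_real (Re z)
      = solenoid_class ((\<xi>, s) \<otimes>\<^bsub>Zhat \<times>\<times> real_add_group\<^esub> (\<one>\<^bsub>Zhat\<^esub>, Re z))"
    unfolding solenoid_of_real_def solenoid_class_def solenoid_def FactGroup_def monoid.simps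
    using assms Z.one_closed by (intro rcos_sum) (simp_all only: mem_Zhat_real_iff)
  moreover have "(\<xi>, s) \<otimes>\<^bsub>Zhat \<times>\<times> real_add_group\<^esub> (\<one>\<^bsub>Zhat\<^esub>, Re z) = (\<xi>, s + Re z)"
    using assms by (simp add: real_add_group_def)
  ultimately show ?thesis
    by (simp add: leaf_param_def)
qed

text \<open>The point \<open>(\<xi>, s + t)\<close> is equivalent to some \<open>(\<eta>, 0)\<close> only when \<open>s + t\<close> is an integer \<open>k\<close>, and
  then \<open>\<eta> = \<xi> - k\<close>.\<close>
lemma leaf_param_mem_Zhat_graph_iff:
  assumes \<xi>: "\<xi> \<in> carrier Zhat" and A: "A \<subseteq> carrier Zhat"
  shows "leaf_param (solenoid_class (\<xi>, s)) z \<in> Zhat_graph A g \<longleftrightarrow>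
    (\<exists>k::int. Zhat_shift \<xi> k \<in> A \<and> z = Complex (real_of_int k - s) (g (Zhat_shift \<xi> k)))"
proof -
  have "leaf_param (solenoid_class (\<xi>, s)) z \<in> Zhat_graph A g \<longleftrightarrow>
    (\<exists>\<eta>\<in>A. solenoid_class (\<xi>, s + Re z) = solenoid_class (\<eta>, 0) \<and> Im z = g \<eta>)"
    unfolding leaf_param_solenoid_class[OF \<xi>] Zhat_graph_def solenoid_of_Zhat_def by auto
  also have "\<dots> \<longleftrightarrow> (\<exists>\<eta>\<in>A. (\<exists>k::int. s + Re z = real_of_int k \<and> \<eta> = Zhat_shift \<xi> k) \<and> Im z = g \<eta>)"
    using A solenoid_class_eq_iff[OF \<xi>] by (intro bex_cong refl) (simp add: subset_eq)
  also have "\<dots> \<longleftrightarrow>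
    (\<exists>k::int. Zhat_shift \<xi> k \<in> A \<and> z = Complex (real_of_int k - s) (g (Zhat_shift \<xi> k)))"
    by (auto simp: complex_eq_iff algebra_simps)
  finally show ?thesis .
qed

text \<open>Parametrizing by \<open>k\<close> makes finiteness and the passage to sums over integers immediate; that this is
  the part of the graph with \<open>\<bar>Re z\<bar> \<le> T\<close> on the leaf of \<open>(\<xi>, s)\<close> is \<open>graph_trace_eq\<close>.\<close>
definition graph_trace ::
    "(nat \<Rightarrow> int) set \<Rightarrow> ((nat \<Rightarrow> int) \<Rightarrow> real) \<Rightarrow> (nat \<Rightarrow> int) \<Rightarrow> real \<Rightarrow> real \<Rightarrow> complex set" where
  "graph_trace A g \<xi> s T =
     (\<lambda>k. Complex (real_of_int k - s) (g (Zhat_shift \<xi> k))) ` {k \<in> window s T. Zhat_shift \<xi> k \<in> A}"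

lemma finite_graph_trace: "finite (graph_trace A g \<xi> s T)"
  by (simp add: graph_trace_def finite_window)

lemma sum_graph_trace:
  "(\<Sum>z\<in>graph_trace A g \<xi> s T. \<psi> (Im z))
     = (\<Sum>k\<in>{k \<in> window s T. Zhat_shift \<xi> k \<in> A}. \<psi> (g (Zhat_shift \<xi> k)))"
proof -
  have "inj_on (\<lambda>k. Complex (real_of_int k - s) (g (Zhat_shift \<xi> k))) B" for B
    by (auto intro!: inj_onI)
  then show ?thesis
    unfolding graph_trace_def by (subst sum.reindex) auto
qed

lemma graph_trace_eq:
  assumes "\<xi> \<in> carrier Zhat" "A \<subseteq> carrier Zhat"
  shows "graph_trace A g \<xi> s T =
    {z. leaf_param (solenoid_class (\<xi>, s)) z \<in> Zhat_graph A g \<and> \<bar>Re z\<bar> \<le> T}"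
  unfolding leaf_param_mem_Zhat_graph_iff[OF assms] graph_trace_def window_def by auto

text \<open>Allowing any finite \<open>Z\<close> that contains the trace lets several graphs be summed over one common set,
  so that points where graphs of opposite signs cancel need no separate treatment.\<close>
lemma sum_indicator_Zhat_graph:
  fixes \<psi> :: "real \<Rightarrow> real"
  assumes "\<xi> \<in> carrier Zhat" "A \<subseteq> carrier Zhat"
    and "finite Z" "graph_trace A g \<xi> s T \<subseteq> Z" "\<And>z. z \<in> Z \<Longrightarrow> \<bar>Re z\<bar> \<le> T"
  shows "(\<Sum>z\<in>Z. indicator (Zhat_graph A g) (leaf_param (solenoid_class (\<xi>, s)) z) * \<psi> (Im z))
     = (\<Sum>k\<in>{k \<in> window s T. Zhat_shift \<xi> k \<in> A}. \<psi> (g (Zhat_shift \<xi> k)))"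
proof -
  have "(\<Sum>z\<in>Z. indicator (Zhat_graph A g) (leaf_param (solenoid_class (\<xi>, s)) z) * \<psi> (Im z))
      = (\<Sum>z\<in>graph_trace A g \<xi> s T. \<psi> (Im z))"
    using assms graph_trace_eq[OF assms(1,2), of g s T]
    by (intro sum.mono_neutral_cong_right) (auto simp: indicator_def)
  then show ?thesis
    by (simp add: sum_graph_trace)
qed

text \<open>Every point has a neighbourhood in a vertical strip, where the support is finite.\<close>
lemma leafwise_discreteI:
  assumes "\<And>x T. x \<in> carrier solenoid \<Longrightarrow> finite {z \<in> leaf_support D x. \<bar>Re z\<bar> \<le> T}"
  shows "leafwise_discrete D"
  unfolding leafwise_discrete_def
proof
  fix x assume x: "x \<in> carrier solenoid"
  have "\<not> w islimpt leaf_support D x" for w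
  proof
    assume w: "w islimpt leaf_support D x"
    have "w islimpt (leaf_support D x \<inter> ball w 1)"
      using w by (rule islimpt_Int_eventually) (intro eventually_at_in_open', auto)
    moreover have "leaf_support D x \<inter> ball w 1 \<subseteq> {z \<in> leaf_support D x. \<bar>Re z\<bar> \<le> \<bar>Re w\<bar> + 1}"
    proof safe
      fix z assume "z \<in> ball w 1"
      then have "\<bar>Re (w - z)\<bar> < 1"
        using abs_Re_le_cmod[of "w - z"] by (simp add: dist_norm)
      then show "\<bar>Re z\<bar> \<le> \<bar>Re w\<bar> + 1"
        by simp
    qed
    ultimately show False
      using assms[OF x] finite_subset islimpt_finite by metis
  qed
  then show "leaf_support D x sparse_in {z. Im z > 0}"
    unfolding sparse_in_def by (metis UNIV_I open_UNIV)
qed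

definition graph_divisor ::
    "nat \<Rightarrow> (nat \<Rightarrow> (nat \<Rightarrow> int) set) \<Rightarrow> (nat \<Rightarrow> (nat \<Rightarrow> int) \<Rightarrow> real) \<Rightarrow> solenoid_point \<times> real \<Rightarrow> int"
  where "graph_divisor p A g w = (\<Sum>j<p. indicator (Zhat_graph (A j) (g j)) w)"

text \<open>The support of \<open>D\<close> may be smaller than the union \<open>Y\<close> of the traces, because of cancellation.  As \<open>D\<close>
  vanishes on the difference, summing over \<open>Y\<close> changes nothing and makes the sum additive in the
  graphs.\<close>
lemma leaf_sum_graph_divisors:
  assumes \<xi>: "\<xi> \<in> carrier Zhat"
    and A: "\<And>j. A j \<subseteq> carrier Zhat" "\<And>j. g j \<in> A j \<rightarrow> {0<..}"
    and B: "\<And>j. B j \<subseteq> carrier Zhat" "\<And>j. h j \<in> B j \<rightarrow> {0<..}"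
    and D: "D = (\<lambda>w. graph_divisor p A g w - graph_divisor q B h w)"
    and x: "x = solenoid_class (\<xi>, s)"
  shows "finite {z \<in> leaf_support D x. \<bar>Re z\<bar> \<le> T}" (is "finite ?Z")
    and "(\<Sum>z\<in>{z \<in> leaf_support D x. \<bar>Re z\<bar> \<le> T}. real_of_int (D (leaf_param x z)) * \<psi> (Im z)) =
      (\<Sum>j<p. \<Sum>k\<in>{k \<in> window s T. Zhat_shift \<xi> k \<in> A j}. \<psi> (g j (Zhat_shift \<xi> k))) -
      (\<Sum>j<q. \<Sum>k\<in>{k \<in> window s T. Zhat_shift \<xi> k \<in> B j}. \<psi> (h j (Zhat_shift \<xi> k)))"
proof -
  define Y where
    "Y = (\<Union>j<p. graph_trace (A j) (g j) \<xi> s T) \<union> (\<Union>j<q. graph_trace (B j) (h j) \<xi> s T)"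
  note trA = graph_trace_eq[OF \<xi> A(1), where s = s, folded x] and trB = graph_trace_eq[OF \<xi> B(1), where s = s, folded x]
  have Y: "finite Y"
    by (auto simp: Y_def finite_graph_trace)
  have Re: "\<bar>Re z\<bar> \<le> T" if "z \<in> Y" for z
    using that by (auto simp: Y_def trA trB)
  have Im: "Im z > 0" if "z \<in> Y" for z
    using that A(2) B(2) by (fastforce simp: Y_def graph_trace_def)
  have sub: "?Z \<subseteq> Y"
  proof
    fix z assume z: "z \<in> ?Z"
    show "z \<in> Y"
    proof (rule ccontr)
      assume "z \<notin> Y"
      then have "leaf_param x z \<notin> Zhat_graph (A j) (g j)" if "j < p" for j
        using that z by (auto simp: Y_def trA)
      moreover have "leaf_param x z \<notin> Zhat_graph (B j) (h j)" if "j < q" for j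
        using that z \<open>z \<notin> Y\<close> by (auto simp: Y_def trB)
      ultimately have "D (leaf_param x z) = 0"
        by (simp add: D graph_divisor_def)
      then show False
        using z by (simp add: leaf_support_def)
    qed
  qed
  show "finite ?Z"
    using sub Y by (rule finite_subset)
  have "(\<Sum>z\<in>?Z. real_of_int (D (leaf_param x z)) * \<psi> (Im z))
      = (\<Sum>z\<in>Y. real_of_int (D (leaf_param x z)) * \<psi> (Im z))"
    using Y sub Im Re by (intro sum.mono_neutral_left) (auto simp: leaf_support_def)
  also have "\<dots> = (\<Sum>j<p. \<Sum>z\<in>Y. indicator (Zhat_graph (A j) (g j)) (leaf_param x z) * \<psi> (Im z))
      - (\<Sum>j<q. \<Sum>z\<in>Y. indicator (Zhat_graph (B j) (h j)) (leaf_param x z) * \<psi> (Im z))"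
  proof -
    have ind: "real_of_int (indicator U w) = indicator U w" for U :: "(solenoid_point \<times> real) set" and w
      by (simp add: indicator_def)
    have "real_of_int (D (leaf_param x z)) * \<psi> (Im z) =
       (\<Sum>j<p. indicator (Zhat_graph (A j) (g j)) (leaf_param x z) * \<psi> (Im z))
      - (\<Sum>j<q. indicator (Zhat_graph (B j) (h j)) (leaf_param x z) * \<psi> (Im z))" for z
      by (simp add: D graph_divisor_def left_diff_distrib sum_distrib_right ind)
    then show ?thesis
      by (simp only: sum_subtractf sum.swap[of _ _ Y])
  qed
  also have "\<dots> = (\<Sum>j<p. \<Sum>k\<in>{k \<in> window s T. Zhat_shift \<xi> k \<in> A j}. \<psi> (g j (Zhat_shift \<xi> k))) -
      (\<Sum>j<q. \<Sum>k\<in>{k \<in> window s T. Zhat_shift \<xi> k \<in> B j}. \<psi> (h j (Zhat_shift \<xi> k)))"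
    unfolding x using Re
    by (intro arg_cong2[where f = "(-)"] sum.cong refl sum_indicator_Zhat_graph \<xi> A(1) B(1) Y)
       (auto simp: Y_def)
  finally show "(\<Sum>z\<in>?Z. real_of_int (D (leaf_param x z)) * \<psi> (Im z)) =
      (\<Sum>j<p. \<Sum>k\<in>{k \<in> window s T. Zhat_shift \<xi> k \<in> A j}. \<psi> (g j (Zhat_shift \<xi> k))) -
      (\<Sum>j<q. \<Sum>k\<in>{k \<in> window s T. Zhat_shift \<xi> k \<in> B j}. \<psi> (h j (Zhat_shift \<xi> k)))" .
qed

section \<open>Lifting a continuous divisor\<close>

lemma compact_support_interval:
  assumes "continuous_divisor_compact_support f"
  obtains a b where "0 < a" "a \<le> b" "\<And>l. 0 < l \<Longrightarrow> f l \<noteq> 0 \<Longrightarrow> l \<in> {a..b}"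
proof -
  define K where "K = closure {l. l > 0 \<and> f l \<noteq> 0}"
  have K: "compact K" "K \<subseteq> {0<..}" "\<And>l. 0 < l \<Longrightarrow> f l \<noteq> 0 \<Longrightarrow> l \<in> K"
    using assms closure_subset[of "{l. l > 0 \<and> f l \<noteq> 0}"]
    by (auto simp: continuous_divisor_compact_support_def K_def simp del: closure_subset)
  show ?thesis
  proof (cases "K = {}")
    case True
    \<comment> \<open>\<open>f\<close> vanishes on the half-line, so any compact interval in it will do\<close>
    then show ?thesis
      using K(3) that[of 1 1] by auto
  next
    case False
    obtain a b where "a \<in> K" "b \<in> K" "\<And>l. l \<in> K \<Longrightarrow> a \<le> l \<and> l \<le> b"
      using compact_attains_inf[OF K(1) False] compact_attains_sup[OF K(1) False] by metis
    then show ?thesis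
      using K that[of a b] by force
  qed
qed

lemma continuous_divisor_pairing_eq_integral:
  assumes "0 < a" "\<And>l. 0 < l \<Longrightarrow> f l \<noteq> 0 \<Longrightarrow> l \<in> {a..b}"
    and "f absolutely_integrable_on {a..b}" "continuous_on {a..b} \<psi>"
  shows "continuous_divisor_pairing f \<psi> = integral {a..b} (\<lambda>x. f x * \<psi> x)"
proof -
  have "indicator {0<..} l *\<^sub>R (f l * \<psi> l) = indicator {a..b} l *\<^sub>R (f l * \<psi> l)" for l
    using assms(1) assms(2)[of l] by (cases "f l = 0") (auto simp: indicator_def)
  then have "continuous_divisor_pairing f \<psi> = (LINT l:{a..b}|lebesgue. f l * \<psi> l)"
    unfolding continuous_divisor_pairing_def set_lebesgue_integral_def by presburger
  then show ?thesis
    using set_lebesgue_integral_eq_integral(2)[OF absolutely_integrable_mult_continuous[OF assms(3,4)]]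
    by simp
qed


theorem theorem5p2:
  fixes f :: "real \<Rightarrow> real"
  assumes "continuous_divisor_compact_support f"
  shows "\<exists>(p::nat) (q::nat)
      (Dp :: nat \<Rightarrow> (nat \<Rightarrow> int) set) (gp :: nat \<Rightarrow> (nat \<Rightarrow> int) \<Rightarrow> real)
      (Dm :: nat \<Rightarrow> (nat \<Rightarrow> int) set) (gm :: nat \<Rightarrow> (nat \<Rightarrow> int) \<Rightarrow> real)
      (D :: solenoid_point \<times> real \<Rightarrow> int).
    (\<forall>j<p. Dp j \<subseteq> carrier Zhat \<and> gp j \<in> Dp j \<rightarrow> {0<..}) \<and>
    (\<forall>j<q. Dm j \<subseteq> carrier Zhat \<and> gm j \<in> Dm j \<rightarrow> {0<..}) \<and>
    D = (\<lambda>w. (\<Sum>j<p. indicator (Zhat_graph (Dp j) (gp j)) w)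
            - (\<Sum>j<q. indicator (Zhat_graph (Dm j) (gm j)) w)) \<and>
    leafwise_discrete D \<and> is_lift D f"
proof -
  obtain a b where ab: "0 < a" "a \<le> b" "\<And>l. 0 < l \<Longrightarrow> f l \<noteq> 0 \<Longrightarrow> l \<in> {a..b}"
    using compact_support_interval[OF assms] by metis
  have pos: "{a..b} \<subseteq> {0<..}"
    using ab(1) by auto
  have f: "f absolutely_integrable_on {a..b}"
    using assms pos unfolding continuous_divisor_compact_support_def
    by (auto intro: set_integrable_subset)
  \<comment> \<open>\<open>f\<close> is the difference of the densities \<open>f + h\<close> and \<open>h\<close>, both at least 1\<close>
  define h where "h x = \<bar>f x\<bar> + 1" for x
  have h: "h absolutely_integrable_on {a..b}"
    unfolding h_def using f by (intro set_integral_add set_integrable_abs) auto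
  have fh: "(\<lambda>x. f x + h x) absolutely_integrable_on {a..b}"
    using f h by (intro set_integral_add)
  have h1: "f x + h x \<ge> 1" "h x \<ge> 1" for x
    by (auto simp: h_def)
  obtain p :: nat and A g where A: "\<And>j. A j \<subseteq> carrier Zhat" "\<And>j. g j \<in> A j \<rightarrow> {a..b}"
    "\<And>\<xi> s \<psi>. \<xi> \<in> carrier Zhat \<Longrightarrow> continuous_on {a..b} \<psi> \<Longrightarrow>
      ((\<lambda>T. 1 / (2 * T) * (\<Sum>j<p. \<Sum>k\<in>{k \<in> window s T. Zhat_shift \<xi> k \<in> A j}.
          \<psi> (g j (Zhat_shift \<xi> k))))
        \<longlongrightarrow> integral {a..b} (\<lambda>x. (f x + h x) * \<psi> x)) at_top"
    by (rule graphs_with_density[OF ab(2) fh h1(1)], rule that)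
  obtain q :: nat and B g' where B: "\<And>j. B j \<subseteq> carrier Zhat" "\<And>j. g' j \<in> B j \<rightarrow> {a..b}"
    "\<And>\<xi> s \<psi>. \<xi> \<in> carrier Zhat \<Longrightarrow> continuous_on {a..b} \<psi> \<Longrightarrow>
      ((\<lambda>T. 1 / (2 * T) * (\<Sum>j<q. \<Sum>k\<in>{k \<in> window s T. Zhat_shift \<xi> k \<in> B j}.
          \<psi> (g' j (Zhat_shift \<xi> k))))
        \<longlongrightarrow> integral {a..b} (\<lambda>x. h x * \<psi> x)) at_top"
    by (rule graphs_with_density[OF ab(2) h h1(2)], rule that)
  have gpos: "g j \<in> A j \<rightarrow> {0<..}" "g' j \<in> B j \<rightarrow> {0<..}" for j
    using A(2)[of j] B(2)[of j] pos by blast+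
  define D where "D = (\<lambda>w. graph_divisor p A g w - graph_divisor q B g' w)"
  note leaf = leaf_sum_graph_divisors[OF _ A(1) gpos(1) B(1) gpos(2) D_def]
  have fin: "finite {z \<in> leaf_support D x. \<bar>Re z\<bar> \<le> T}" if "x \<in> carrier solenoid" for x T
    using solenoid_cases[OF that] leaf(1) by metis
  have "((\<lambda>T. 1 / (2 * T) * (\<Sum>z\<in>{z \<in> leaf_support D x. \<bar>Re z\<bar> \<le> T}.
           real_of_int (D (leaf_param x z)) * \<psi> (Im z)))
         \<longlongrightarrow> continuous_divisor_pairing f \<psi>) at_top"
    if x: "x \<in> carrier solenoid" and "continuous_on {0<..} \<psi>" for x \<psi>
  proof -
    have \<psi>: "continuous_on {a..b} \<psi>"
      using that(2) pos by (rule continuous_on_subset)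
    obtain \<xi> s where \<xi>: "\<xi> \<in> carrier Zhat" "x = solenoid_class (\<xi>, s)"
      using solenoid_cases[OF x] by metis
    have "integral {a..b} (\<lambda>x. (f x + h x) * \<psi> x) - integral {a..b} (\<lambda>x. h x * \<psi> x)
        = integral {a..b} (\<lambda>x. (f x + h x) * \<psi> x - h x * \<psi> x)"
      using absolutely_integrable_mult_continuous[OF _ \<psi>] fh h
      by (intro integral_diff[symmetric]) (auto simp: absolutely_integrable_on_def)
    also have "\<dots> = integral {a..b} (\<lambda>x. f x * \<psi> x)"
      by (simp add: algebra_simps)
    also have "\<dots> = continuous_divisor_pairing f \<psi>"
      using continuous_divisor_pairing_eq_integral[OF ab(1,3) f \<psi>] by simp
    finally show ?thesis
      using tendsto_diff[OF A(3)[OF \<xi>(1) \<psi>, of s] B(3)[OF \<xi>(1) \<psi>, of s]]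
      unfolding leaf(2)[OF \<xi>] by (simp only: right_diff_distrib)
  qed
  then have "is_lift D f"
    using fin by (simp add: is_lift_def)
  moreover have "leafwise_discrete D"
    using fin by (rule leafwise_discreteI)
  ultimately show ?thesis
    using A(1) B(1) gpos by (intro exI[of _ p] exI[of _ q] exI[of _ A] exI[of _ g] exI[of _ B]
        exI[of _ g'] exI[of _ D]) (simp add: D_def graph_divisor_def)
qed

end
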